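(* Let $n\ge 2$, $\mathcal{D}=\mathbb{C}[D_1,\dots,D_n]$ and $\mathcal{F}=\mathcal{C}^\infty(\mathsf{PT})_{\mathsf{fin}}$. For an ideal $\mathfrak{i}\subset\mathcal{D}$ put $\mathcal{S}(\mathfrak{i})=\mathcal{V}(\mathfrak{i})\cap\mathbb{Q}^n$. Then an element $f\in\mathcal{F}$ belongs to $\mathfrak{i}^\perp$ if and only if the support of $f$ lies in $\mathcal{S}(\mathfrak{i})$. Further, $\mathfrak{i}^{\perp\perp}$ consists of all polynomials in $\mathcal{D}$ which are zero on $\mathcal{S}(\mathfrak{i})$, that is, $\mathfrak{i}^{\perp\perp}=\bigcap_{a\in\mathcal{S}(\mathfrak{i})}(D_1-a_1,\dots,D_n-a_n)$; equivalently, $\mathfrak{i}^{\perp\perp}$ is the reduced ideal of the Zariski closure of $\mathcal{S}(\mathfrak{i})$. In this way, the behaviors $\mathcal{B}\subset\mathcal{F}$ are in one-to-one correspondence with the Zariski closed subsets $S$ of $\mathbb{C}^n$ such that $S\cap\mathbb{Q}^n$ is Zariski dense in $S$.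
   Context: $\mathcal{D}=\mathbb{C}[D_1,\dots,D_n]$ is the commutative polynomial ring of constant coefficient differential operators on $\mathbb{R}^n$, with $D_j=\frac{1}{\imath}\frac{\partial}{\partial x_j}$. For an ideal $\mathfrak{i}\subset\mathcal{D}$, $\mathcal{V}(\mathfrak{i})=\{a\in\mathbb{C}^n : L(a)=0 \text{ for all } L\in\mathfrak{i}\}$, with $L(a)$ the evaluation at $D_j=a_j$. $\mathcal{C}^\infty(\mathsf{PT})_{\mathsf{fin}}$ is the $\mathcal{D}$-module of finite sums $f=\sum_{a\in\mathbb{Q}^n}c_ae^{\imath\langle a,x\rangle}$, $c_a\in\mathbb{C}$, $\langle a,x\rangle=\sum_ja_jx_j$; the support of $f$ is $\{a\in\mathbb{Q}^n : c_a\ne 0\}$. For an ideal $\mathfrak{i}$, $\mathfrak{i}^\perp=\{f\in\mathcal{F} : r(f)=0 \text{ for all } r\in\mathfrak{i}\}$; the subsets of $\mathcal{F}$ of this form are the behaviors in $\mathcal{F}$. For a behavior $\mathcal{B}$, $\mathcal{B}^\perp=\{r\in\mathcal{D} : r(f)=0 \text{ for all } f\in\mathcal{B}\}$, and $\mathfrak{i}^{\perp\perp}=(\mathfrak{i}^\perp)^\perp$. An intersection over the empty set is $\mathcal{D}$. The correspondence assigns to the behavior $\mathcal{B}=\mathfrak{i}^\perp$ the Zariski closure of $\mathcal{S}(\mathfrak{i})$, equivalently $\mathcal{V}(\mathcal{B}^\perp)$. *)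

theory Defs
  imports "HOL-Analysis.Analysis" "HOL-Library.Poly_Mapping"
begin

text \<open>
  The ring \<open>\<complex>[D\<^sub>1,\<dots>,D\<^sub>n]\<close> is the monoid algebra of finitely supported exponent vectors
  \<open>'n \<Rightarrow>\<^sub>0 nat\<close>, where the finite type \<open>'n\<close> plays the role of \<open>{1,\<dots>,n}\<close>; its
  multiplication is the convolution product of \<^theory>\<open>HOL-Library.Poly_Mapping\<close>.
\<close>

type_synonym 'n diffop = "('n \<Rightarrow>\<^sub>0 nat) \<Rightarrow>\<^sub>0 complex"

definition var :: "'n \<Rightarrow> 'n diffop"
  where "var j = Poly_Mapping.single (Poly_Mapping.single j 1) 1"

definition const :: "complex \<Rightarrow> 'n diffop"
  where "const c = Poly_Mapping.single 0 c"

definition eval :: "'n::finite diffop \<Rightarrow> complex ^ 'n \<Rightarrow> complex"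
  where "eval p a = (\<Sum>m\<in>Poly_Mapping.keys p. Poly_Mapping.lookup p m *
    (\<Prod>j\<in>UNIV. (a $ j) ^ Poly_Mapping.lookup m j))"

text \<open>Ideals are the submodules of the ring regarded as a module over itself.\<close>

lemma module_times: "module ((*) :: 'a::comm_ring_1 \<Rightarrow> 'a \<Rightarrow> 'a)"
  by unfold_locales (simp_all add: algebra_simps)

definition is_ideal :: "'a::comm_ring_1 set \<Rightarrow> bool"
  where "is_ideal I \<longleftrightarrow> module.subspace (*) I"

definition ideal_generated :: "'a::comm_ring_1 set \<Rightarrow> 'a set"
  where "ideal_generated G = module.span (*) G"

lemma is_ideal_iff:
  "is_ideal I \<longleftrightarrow> 0 \<in> I \<and> (\<forall>p\<in>I. \<forall>q\<in>I. p + q \<in> I) \<and> (\<forall>r. \<forall>p\<in>I. r * p \<in> I)"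
  by (auto simp: is_ideal_def module.subspace_def[OF module_times])

section \<open>Affine varieties\<close>

definition variety :: "'n::finite diffop set \<Rightarrow> (complex ^ 'n) set"
  where "variety I = {a. \<forall>L\<in>I. eval L a = 0}"

definition vanishing_ideal :: "(complex ^ 'n::finite) set \<Rightarrow> 'n diffop set"
  where "vanishing_ideal S = {p. \<forall>a\<in>S. eval p a = 0}"

definition zariski_closed :: "(complex ^ 'n::finite) set \<Rightarrow> bool"
  where "zariski_closed S \<longleftrightarrow> (\<exists>J. is_ideal J \<and> S = variety J)"

definition zariski_closure :: "(complex ^ 'n::finite) set \<Rightarrow> (complex ^ 'n) set"
  where "zariski_closure S = zariski_closed hull S"

text \<open>\<open>\<rat>\<^sup>n\<close> as a subset of \<open>\<complex>\<^sup>n\<close>.\<close>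

definition rational_points :: "(complex ^ 'n::finite) set"
  where "rational_points = {a. \<forall>j. a $ j \<in> \<rat>}"

definition rational_variety :: "'n::finite diffop set \<Rightarrow> (complex ^ 'n) set"
  where "rational_variety I = variety I \<inter> rational_points"

section \<open>Trigonometric sums with rational frequencies\<close>

definition exponential :: "complex ^ 'n::finite \<Rightarrow> real ^ 'n \<Rightarrow> complex"
  where "exponential a x = exp (\<i> * (\<Sum>j\<in>UNIV. a $ j * complex_of_real (x $ j)))"

definition trig_sum :: "(complex ^ 'n::finite \<Rightarrow>\<^sub>0 complex) \<Rightarrow> real ^ 'n \<Rightarrow> complex"
  where "trig_sum c x = (\<Sum>a\<in>Poly_Mapping.keys c. Poly_Mapping.lookup c a * exponential a x)"

definition PT_fin :: "(real ^ 'n::finite \<Rightarrow> complex) set"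
  where "PT_fin = {trig_sum c | c. Poly_Mapping.keys c \<subseteq> rational_points}"

text \<open>
  The coefficient family of an element of \<^const>\<open>PT_fin\<close> is unique,
  see \<open>PT_fin_coeffs_unique\<close> below.
\<close>

definition fourier_coeffs :: "(real ^ 'n::finite \<Rightarrow> complex) \<Rightarrow> (complex ^ 'n \<Rightarrow>\<^sub>0 complex)"
  where "fourier_coeffs f =
    (THE c. Poly_Mapping.keys c \<subseteq> rational_points \<and> f = trig_sum c)"

definition supp :: "(real ^ 'n::finite \<Rightarrow> complex) \<Rightarrow> (complex ^ 'n) set"
  where "supp f = {a. Poly_Mapping.lookup (fourier_coeffs f) a \<noteq> 0}"

lemma exponential_add: "exponential a (x + y) = exponential a x * exponential a y"
  by (simp add: exponential_def exp_add[symmetric] sum.distrib algebra_simps)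

lemma exponential_separates:
  assumes "a \<in> rational_points" "b \<in> rational_points" "a \<noteq> b"
  shows "\<exists>y. exponential a y \<noteq> exponential b y"
proof -
  obtain j where j: "a $ j \<noteq> b $ j" using assms(3) by (auto simp: vec_eq_iff)
  obtain p q where p: "a $ j = of_rat p" and q: "b $ j = of_rat q"
    using assms(1,2) unfolding rational_points_def by (metis Rats_cases mem_Collect_eq)
  define t where "t = pi / (of_rat p - of_rat q :: real)"
  have pq: "(of_rat p :: real) \<noteq> of_rat q" using j p q by auto
  have e: "exponential c (axis j t) = exp (\<i> * (c $ j * of_real t))" for c :: "complex ^ 'a"
  proof -
    have "(\<Sum>k\<in>UNIV. c $ k * complex_of_real (axis j t $ k)) =
        (\<Sum>k\<in>UNIV. if k = j then c $ j * of_real t else 0)"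
      by (rule sum.cong) (auto simp: axis_def)
    then show ?thesis by (simp add: exponential_def)
  qed
  have R: "(of_rat r :: complex) = of_real (of_rat r)" for r
    by (cases r) (simp add: of_rat_rat)
  have "(of_rat p :: real) * t = of_rat q * t + pi"
    using pq by (simp add: t_def field_simps)
  then have "a $ j * of_real t = b $ j * of_real t + of_real pi"
    unfolding p q R by (metis of_real_add of_real_mult)
  then have "exponential a (axis j t) = - exponential b (axis j t)"
    by (simp add: e distrib_left exp_add)
  moreover have "exponential b (axis j t) \<noteq> 0" by (simp add: exponential_def)
  ultimately show ?thesis by (intro exI[of _ "axis j t"]) auto
qed

lemma exponentials_independent:
  assumes "finite A" "A \<subseteq> rational_points" "\<And>x. (\<Sum>a\<in>A. c a * exponential a x) = 0"
  shows "\<forall>a\<in>A. c a = 0"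
  using assms
proof (induction A arbitrary: c rule: finite_induct)
  case empty
  then show ?case by simp
next
  case (insert b A)
  have z: "c a = 0" if a: "a \<in> A" for a
  proof -
    have ab: "a \<noteq> b" using a insert.hyps by auto
    then obtain y where y: "exponential a y \<noteq> exponential b y"
      using exponential_separates[of a b] insert.prems(1) a by auto
    have "(\<Sum>a\<in>A. (c a * (exponential a y - exponential b y)) * exponential a x) = 0" for x
    proof -
      have "(\<Sum>a\<in>insert b A. c a * exponential a (x + y)) -
          exponential b y * (\<Sum>a\<in>insert b A. c a * exponential a x) = 0"
        using insert.prems(2) by simp
      then show ?thesis
        using insert.hyps
        by (simp add: exponential_add algebra_simps sum_distrib_left sum_subtractf)
    qed
    from insert.IH[OF _ this] insert.prems(1) a y show ?thesis by auto
  qed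
  have "c b * exponential b 0 = 0"
    using insert.prems(2)[of 0] insert.hyps z by simp
  then show ?case using z by (auto simp: exponential_def)
qed

lemma PT_fin_coeffs_unique:
  assumes "Poly_Mapping.keys c \<subseteq> rational_points" "Poly_Mapping.keys d \<subseteq> rational_points"
    and "trig_sum c = trig_sum d"
  shows "c = d"
proof -
  define A where "A = Poly_Mapping.keys c \<union> Poly_Mapping.keys d"
  have A: "finite A" "A \<subseteq> rational_points" using assms by (auto simp: A_def)
  have ext: "trig_sum e x = (\<Sum>a\<in>A. Poly_Mapping.lookup e a * exponential a x)"
    if "Poly_Mapping.keys e \<subseteq> A" for e x
    unfolding trig_sum_def using that A(1)
    by (intro sum.mono_neutral_left) (auto simp: in_keys_iff)
  have "(\<Sum>a\<in>A. (Poly_Mapping.lookup c a - Poly_Mapping.lookup d a) * exponential a x) = 0" for x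
    using fun_cong[OF assms(3), of x] ext[of c x] ext[of d x]
    by (simp add: A_def algebra_simps sum_subtractf)
  from exponentials_independent[OF A this]
  have "\<forall>a\<in>A. Poly_Mapping.lookup c a = Poly_Mapping.lookup d a" by simp
  then show ?thesis
    by (intro poly_mapping_eqI) (metis A_def UnI1 UnI2 in_keys_iff)
qed

lemma fourier_coeffs_trig_sum:
  "Poly_Mapping.keys c \<subseteq> rational_points \<Longrightarrow> fourier_coeffs (trig_sum c) = c"
  unfolding fourier_coeffs_def by (rule the_equality) (auto dest: PT_fin_coeffs_unique)

section \<open>The action of differential operators\<close>

definition Dpartial :: "'n::finite \<Rightarrow> (real ^ 'n \<Rightarrow> complex) \<Rightarrow> real ^ 'n \<Rightarrow> complex"
  where "Dpartial j f x = 1 / \<i> * vector_derivative (\<lambda>t. f (x + t *\<^sub>R axis j 1)) (at 0)"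

text \<open>
  The linear order on the index type only fixes the order in which the iterated partial
  derivatives are taken; it is immaterial on smooth functions.
\<close>

definition Dmonom ::
    "('n::{finite,linorder} \<Rightarrow>\<^sub>0 nat) \<Rightarrow>
      (real ^ 'n::{finite,linorder} \<Rightarrow> complex) \<Rightarrow> real ^ 'n::{finite,linorder} \<Rightarrow> complex"
  where "Dmonom m f =
    foldr (\<lambda>j g. (Dpartial j ^^ Poly_Mapping.lookup m j) g) (sorted_list_of_set UNIV) f"

definition act ::
    "'n::{finite,linorder} diffop \<Rightarrow>
      (real ^ 'n::{finite,linorder} \<Rightarrow> complex) \<Rightarrow> real ^ 'n::{finite,linorder} \<Rightarrow> complex"
  where "act p f x = (\<Sum>m\<in>Poly_Mapping.keys p. Poly_Mapping.lookup p m * Dmonom m f x)"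

lemma Dpartial_exponential:
  "Dpartial j (\<lambda>x. c * exponential a x) = (\<lambda>x. (c * a $ j) * exponential a x)"
proof
  fix x :: "real ^ 'a"
  have "exponential a (x + t *\<^sub>R axis j 1) = exponential a x * exp (\<i> * (a $ j * of_real t))" for t
  proof -
    have "(\<Sum>k\<in>UNIV. a $ k * complex_of_real ((t *\<^sub>R axis j 1) $ k)) =
        (\<Sum>k\<in>UNIV. if k = j then a $ j * of_real t else 0)"
      by (rule sum.cong) (auto simp: axis_def)
    then show ?thesis unfolding exponential_add by (simp add: exponential_def)
  qed
  moreover have "((\<lambda>t. c * (exponential a x * exp (\<i> * (a $ j * of_real t)))) has_vector_derivative
      c * (exponential a x * (\<i> * a $ j))) (at 0)"
    by (rule has_vector_derivative_real_field) (auto intro!: derivative_eq_intros)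
  ultimately show "Dpartial j (\<lambda>x. c * exponential a x) x = (c * a $ j) * exponential a x"
    by (simp add: Dpartial_def vector_derivative_at)
      (simp add: mult.left_commute[of _ \<i>] mult.assoc[symmetric], simp add: mult_ac)
qed

lemma Dmonom_exponential:
  "Dmonom m (exponential a) =
    (\<lambda>x. (\<Prod>j\<in>UNIV. (a $ j) ^ Poly_Mapping.lookup m j) * exponential a x)"
proof -
  have pow: "(Dpartial j ^^ k) (\<lambda>x. c * exponential a x) =
      (\<lambda>x. (c * (a $ j) ^ k) * exponential a x)" for j k c
    by (induction k) (simp, simp add: Dpartial_exponential, simp add: mult_ac)
  have "foldr (\<lambda>j g. (Dpartial j ^^ Poly_Mapping.lookup m j) g) js (exponential a) =
      (\<lambda>x. (\<Prod>j\<leftarrow>js. (a $ j) ^ Poly_Mapping.lookup m j) * exponential a x)" for js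
    by (induction js) (simp, simp add: pow, simp add: mult_ac)
  from this[of "sorted_list_of_set UNIV"] show ?thesis
    by (simp add: Dmonom_def prod.distinct_set_conv_list[symmetric])
qed

lemma act_exponential: "act p (exponential a) = (\<lambda>x. eval p a * exponential a x)"
  by (simp add: act_def eval_def Dmonom_exponential sum_distrib_left mult_ac fun_eq_iff)

section \<open>Behaviors\<close>

definition orth :: "'n::{finite,linorder} diffop set \<Rightarrow> (real ^ 'n::{finite,linorder} \<Rightarrow> complex) set"
  where "orth I = {f \<in> PT_fin. \<forall>r\<in>I. act r f = (\<lambda>x. 0)}"

definition annihilator :: "(real ^ 'n::{finite,linorder} \<Rightarrow> complex) set \<Rightarrow> 'n diffop set"
  where "annihilator B = {r. \<forall>f\<in>B. act r f = (\<lambda>x. 0)}"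

definition behaviors :: "(real ^ 'n::{finite,linorder} \<Rightarrow> complex) set set"
  where "behaviors = {orth I | I. is_ideal I}"

end

theory Submission
  imports Defs
begin

text \<open>
  The exponentials with frequencies in \<open>S(i) = V(i) \<inter> \<rat>\<^sup>n\<close> are joint eigenfunctions, an operator
  \<open>p\<close> acting on \<open>e\<^bsup>i\<langle>a,x\<rangle>\<^esup>\<close> as the scalar \<open>p(a)\<close>. Since they are linearly independent,
  \<open>p\<close> kills a trigonometric sum iff it vanishes on the support, so \<open>i\<^sup>\<bottom>\<close> is spanned by the exponentials
  with frequency in \<open>S(i)\<close> and \<open>i\<^sup>\<bottom>\<^sup>\<bottom>\<close> is the vanishing ideal of \<open>S(i)\<close>. The correspondence then rests on
  the fact that the closure of \<open>S(i)\<close> stays inside \<open>V(i)\<close>, hence has no new rational points.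
\<close>

section \<open>Evaluation of polynomials\<close>

text \<open>Updating at a fresh key amounts to adding a \<open>single\<close> there, so every
  finitely supported function is a finite sum of singles. This reduces additive claims to
  monomials.\<close>

lemma poly_mapping_additive_induct [case_names zero single add]:
  assumes "P 0" and "\<And>a b. P (Poly_Mapping.single a b)"
    and "\<And>f g. P f \<Longrightarrow> P g \<Longrightarrow> P (f + g)"
  shows "P (f :: 'a \<Rightarrow>\<^sub>0 'b::comm_monoid_add)"
proof (induction f rule: Poly_Mapping.update_induct)
  case const
  show ?case by (rule assms(1))
next
  case (update f a b)
  then have "Poly_Mapping.update a b f = f + Poly_Mapping.single a b"
    by (intro poly_mapping_eqI)
      (auto simp: lookup_update lookup_add lookup_single in_keys_iff when_def)
  with assms(2,3) update.IH show ?case by simp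
qed

lemma single_eq_var_power: "Poly_Mapping.single (Poly_Mapping.single j k) 1 = var j ^ k"
proof (induction k)
  case (Suc k)
  have "var j ^ Suc k = Poly_Mapping.single (Poly_Mapping.single j 1 + Poly_Mapping.single j k) 1"
    unfolding power_Suc Suc.IH[symmetric] by (simp add: var_def mult_single)
  also have "Poly_Mapping.single j 1 + Poly_Mapping.single j k = Poly_Mapping.single j (Suc k)"
    by (simp add: single_add[symmetric])
  finally show ?case by simp
qed simp

text \<open>Constants and variables generate the ring, since a monomial is a product of powers of
  variables. The rule serves claims stable under sums and products, such as a congruence modulo an
  ideal.\<close>

lemma diffop_induct [case_names const var add mult]:
  fixes p :: "'n diffop"
  assumes const: "\<And>c. P (const c)" and var: "\<And>j. P (var j)"
    and add: "\<And>p q. P p \<Longrightarrow> P q \<Longrightarrow> P (p + q)"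
    and mult: "\<And>p q. P p \<Longrightarrow> P q \<Longrightarrow> P (p * q)"
  shows "P p"
proof (induction p rule: poly_mapping_additive_induct)
  case zero
  show ?case using const[of 0] by (simp add: const_def)
next
  case (single m c)
  have one: "P 1" using const[of 1] by (simp add: const_def)
  have "P (Poly_Mapping.single m 1)"
  proof (induction m rule: poly_mapping_additive_induct)
    case zero
    show ?case using one by simp
  next
    case (single j k)
    show ?case unfolding single_eq_var_power
      by (induction k) (auto simp: one intro: mult var)
  next
    case (add m m')
    then show ?case using mult[OF add] by (simp add: mult_single)
  qed
  from mult[OF const[of c] this] show ?case by (simp add: const_def mult_single)
next
  case (add p q)
  then show ?case by (rule assms(3))
qed

text \<open>Terms may cancel in \<open>p + q\<close>, so key sets of summands and sum can differ; a
  common finite index set makes the sums comparable.\<close>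

lemma eval_eq_sum:
  assumes "finite A" "Poly_Mapping.keys p \<subseteq> A"
  shows "eval p a = (\<Sum>m\<in>A. Poly_Mapping.lookup p m *
    (\<Prod>j\<in>UNIV. (a $ j) ^ Poly_Mapping.lookup m j))"
  unfolding eval_def using assms
  by (intro sum.mono_neutral_left) (auto simp: in_keys_iff)

lemma eval_add: "eval (p + q) a = eval p a + eval q a"
proof -
  define A where "A = Poly_Mapping.keys p \<union> Poly_Mapping.keys q"
  have A: "finite A" "Poly_Mapping.keys p \<subseteq> A" "Poly_Mapping.keys q \<subseteq> A"
      "Poly_Mapping.keys (p + q) \<subseteq> A"
    using keys_add[of p q] by (auto simp: A_def)
  show ?thesis
    by (simp only: A eval_eq_sum[of A] lookup_add distrib_right sum.distrib)
qed

lemma eval_zero [simp]: "eval 0 a = 0"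
  by (simp add: eval_def)

lemma eval_single:
  "eval (Poly_Mapping.single m c) a = c * (\<Prod>j\<in>UNIV. (a $ j) ^ Poly_Mapping.lookup m j)"
  by (subst eval_eq_sum[of "{m}"]) auto

lemma eval_const [simp]: "eval (const c) a = c"
  by (simp add: const_def eval_single)

lemma eval_var [simp]: "eval (var j) a = a $ j"
proof -
  have "(\<Prod>k\<in>UNIV. (a $ k) ^ Poly_Mapping.lookup (Poly_Mapping.single j 1) k) =
      (\<Prod>k\<in>UNIV. if k = j then a $ j else 1)"
    by (rule prod.cong) (auto simp: lookup_single)
  then show ?thesis by (simp add: var_def eval_single)
qed

text \<open>Both sides are additive in \<open>p\<close> and in \<open>q\<close>, which leaves
  monomials, where multiplication adds exponents.\<close>

lemma eval_mult: "eval (p * q) a = eval p a * eval q a"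
proof (induction p rule: poly_mapping_additive_induct)
  case (single m c)
  show ?case
  proof (induction q rule: poly_mapping_additive_induct)
    case (single m' c')
    show ?case
      by (simp add: mult_single eval_single lookup_add power_add prod.distrib)
  qed (simp_all add: eval_add distrib_left)
qed (simp_all add: eval_add distrib_right)

lemma eval_diff: "eval (p - q) a = eval p a - eval q a"
  using eval_add[of "p - q" q a] by simp

section \<open>Vanishing ideals and Zariski closure\<close>

lemma is_ideal_ideal_generated: "is_ideal (ideal_generated G)"
  unfolding is_ideal_def ideal_generated_def by (rule module.subspace_span[OF module_times])

lemma is_ideal_vanishing_ideal: "is_ideal (vanishing_ideal S)"
  by (simp add: is_ideal_iff vanishing_ideal_def eval_add eval_mult)

lemma ideal_generated_minimal: "G \<subseteq> I \<Longrightarrow> is_ideal I \<Longrightarrow> ideal_generated G \<subseteq> I"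
  unfolding is_ideal_def ideal_generated_def by (rule module.span_minimal[OF module_times])

lemma ideal_generated_superset: "G \<subseteq> ideal_generated G"
  unfolding ideal_generated_def by (rule module.span_superset[OF module_times])

text \<open>Modulo the ideal each variable is congruent to its value at \<open>a\<close>, hence each
  \<open>p\<close> to the constant \<open>eval p a\<close>. If this value is zero, \<open>p\<close>
  itself lies in the ideal.\<close>

lemma maximal_ideal_eq_vanishing_ideal:
  "ideal_generated (range (\<lambda>j. var j - const (a $ j))) = vanishing_ideal {a}" (is "?J = _")
proof
  show "?J \<subseteq> vanishing_ideal {a}"
    by (rule ideal_generated_minimal[OF _ is_ideal_vanishing_ideal])
      (auto simp: vanishing_ideal_def eval_diff)
next
  have J_zero: "0 \<in> ?J" and J_add: "\<And>p q. p \<in> ?J \<Longrightarrow> q \<in> ?J \<Longrightarrow> p + q \<in> ?J"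
    and J_mult: "\<And>r p. p \<in> ?J \<Longrightarrow> r * p \<in> ?J"
    using is_ideal_ideal_generated[of "range (\<lambda>j. var j - const (a $ j))"]
    by (auto simp: is_ideal_iff)
  have const_add: "const (c + d) = (const c + const d :: 'a diffop)" for c d
    by (simp add: const_def single_add)
  have const_mult: "const (c * d) = (const c * const d :: 'a diffop)" for c d
    by (simp add: const_def mult_single)
  have cong: "p - const (eval p a) \<in> ?J" for p
  proof (induction p rule: diffop_induct)
    case (const c)
    show ?case by (simp add: J_zero)
  next
    case (var j)
    show ?case using ideal_generated_superset by fastforce
  next
    case (add p q)
    show ?case using J_add[OF add]
      by (simp add: eval_add const_add add_diff_add)
  next
    case (mult p q)
    \<comment> \<open>A splitting as in the product rule: both terms are multiples of differences
      covered by the induction hypotheses.\<close>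
    have "p * q - const (eval (p * q) a) =
        p * (q - const (eval q a)) + const (eval q a) * (p - const (eval p a))"
      by (simp add: eval_mult const_mult algebra_simps)
    then show ?case using mult.IH J_mult J_add by simp
  qed
  show "vanishing_ideal {a} \<subseteq> ?J"
  proof
    fix p assume "p \<in> vanishing_ideal {a}"
    then show "p \<in> ?J" using cong[of p] by (simp add: vanishing_ideal_def const_def)
  qed
qed

text \<open>If \<open>variety J\<close> contains \<open>S\<close>, then \<open>J\<close> lies in
  \<open>vanishing_ideal S\<close>, and passing to varieties reverses this inclusion.\<close>

lemma zariski_closure_eq: "zariski_closure S = variety (vanishing_ideal S)"
  unfolding zariski_closure_def
proof (rule hull_unique)
  show "S \<subseteq> variety (vanishing_ideal S)"
    by (auto simp: variety_def vanishing_ideal_def)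
  show "zariski_closed (variety (vanishing_ideal S))"
    using is_ideal_vanishing_ideal by (auto simp: zariski_closed_def)
  show "variety (vanishing_ideal S) \<subseteq> T" if "S \<subseteq> T" "zariski_closed T" for T
    using that by (fastforce simp: variety_def vanishing_ideal_def zariski_closed_def)
qed

lemma zariski_closed_variety: "is_ideal I \<Longrightarrow> zariski_closed (variety I)"
  by (auto simp: zariski_closed_def)

lemma vanishing_ideal_zariski_closure: "vanishing_ideal (zariski_closure S) = vanishing_ideal S"
  unfolding zariski_closure_eq by (auto simp: variety_def vanishing_ideal_def)

lemma zariski_closure_rational_variety_subset:
  "is_ideal I \<Longrightarrow> zariski_closure (rational_variety I) \<subseteq> variety I"
  unfolding zariski_closure_def
  by (rule hull_minimal) (auto simp: rational_variety_def zariski_closed_variety)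

text \<open>The closure lies between \<open>rational_variety I\<close> and \<open>variety I\<close>,
  which have the same rational points. This makes the correspondence injective.\<close>

lemma zariski_closure_rational_points:
  "is_ideal I \<Longrightarrow> zariski_closure (rational_variety I) \<inter> rational_points = rational_variety I"
  using zariski_closure_rational_variety_subset[of I] hull_subset[of "rational_variety I"]
  by (auto simp: rational_variety_def zariski_closure_def)

section \<open>The action on trigonometric sums\<close>

text \<open>Differentiating a sum termwise requires that each derivative exists; the value in
  \<open>Dpartial_exponential\<close> alone does not say so.\<close>

lemma exponential_has_partial_derivative:
  "((\<lambda>t. exponential a (x + t *\<^sub>R axis j 1)) has_vector_derivative
    \<i> * a $ j * exponential a x) (at 0)"
proof -
  have "exponential a (x + t *\<^sub>R axis j 1) = exponential a x * exp (\<i> * (a $ j * of_real t))" for t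
  proof -
    have "(\<Sum>k\<in>UNIV. a $ k * complex_of_real ((t *\<^sub>R axis j 1) $ k)) =
        (\<Sum>k\<in>UNIV. if k = j then a $ j * of_real t else 0)"
      by (rule sum.cong) (auto simp: axis_def)
    then show ?thesis unfolding exponential_add by (simp add: exponential_def)
  qed
  moreover have "((\<lambda>t. exponential a x * exp (\<i> * (a $ j * of_real t))) has_vector_derivative
      \<i> * a $ j * exponential a x) (at 0)"
    by (rule has_vector_derivative_real_field) (auto intro!: derivative_eq_intros)
  ultimately show ?thesis by simp
qed

lemma Dpartial_sum_exponential:
  "Dpartial j (\<lambda>x. \<Sum>a\<in>A. c a * exponential a x) = (\<lambda>x. \<Sum>a\<in>A. (c a * a $ j) * exponential a x)"
proof
  fix x
  have "((\<lambda>t. \<Sum>a\<in>A. c a * exponential a (x + t *\<^sub>R axis j 1)) has_vector_derivative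
      (\<Sum>a\<in>A. c a * (\<i> * a $ j * exponential a x))) (at 0)"
    by (intro has_vector_derivative_sum has_vector_derivative_mult_right
        exponential_has_partial_derivative)
  then show "Dpartial j (\<lambda>x. \<Sum>a\<in>A. c a * exponential a x) x =
      (\<Sum>a\<in>A. (c a * a $ j) * exponential a x)"
    by (simp add: Dpartial_def vector_derivative_at sum_distrib_left mult_ac
        flip: sum_divide_distrib)
qed

lemma Dmonom_sum_exponential:
  "Dmonom m (\<lambda>x. \<Sum>a\<in>A. c a * exponential a x) =
    (\<lambda>x. \<Sum>a\<in>A. (c a * (\<Prod>j\<in>UNIV. (a $ j) ^ Poly_Mapping.lookup m j)) * exponential a x)"
proof -
  have pow: "(Dpartial j ^^ k) (\<lambda>x. \<Sum>a\<in>A. c a * exponential a x) =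
      (\<lambda>x. \<Sum>a\<in>A. (c a * (a $ j) ^ k) * exponential a x)" for j k c
    by (induction k) (simp, simp add: Dpartial_sum_exponential, simp add: mult_ac)
  have "foldr (\<lambda>j g. (Dpartial j ^^ Poly_Mapping.lookup m j) g) js
      (\<lambda>x. \<Sum>a\<in>A. c a * exponential a x) =
      (\<lambda>x. \<Sum>a\<in>A. (c a * (\<Prod>j\<leftarrow>js. (a $ j) ^ Poly_Mapping.lookup m j)) * exponential a x)" for js
    by (induction js) (simp, simp add: pow, simp add: mult_ac)
  from this[of "sorted_list_of_set UNIV"] show ?thesis
    by (simp add: Dmonom_def prod.distinct_set_conv_list[symmetric])
qed

text \<open>Each exponential is an eigenfunction with eigenvalue \<open>eval p a\<close>;
  interchanging the sums over monomials and frequencies collects these values.\<close>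

lemma act_trig_sum:
  "act p (trig_sum c) =
    (\<lambda>x. \<Sum>a\<in>Poly_Mapping.keys c. (Poly_Mapping.lookup c a * eval p a) * exponential a x)"
  unfolding trig_sum_def[abs_def] act_def Dmonom_sum_exponential
  by (subst sum_distrib_left, subst sum.swap)
    (simp add: eval_def sum_distrib_left sum_distrib_right mult_ac)

text \<open>By independence of the exponentials all new coefficients vanish, and the old ones are
  nonzero on the keys.\<close>

lemma act_trig_sum_eq_0_iff:
  assumes "Poly_Mapping.keys c \<subseteq> rational_points"
  shows "act p (trig_sum c) = (\<lambda>x. 0) \<longleftrightarrow> (\<forall>a\<in>Poly_Mapping.keys c. eval p a = 0)"
proof
  assume "act p (trig_sum c) = (\<lambda>x. 0)"
  then have "\<forall>a\<in>Poly_Mapping.keys c. Poly_Mapping.lookup c a * eval p a = 0"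
    by (intro exponentials_independent[OF _ assms]) (auto simp: act_trig_sum fun_eq_iff)
  then show "\<forall>a\<in>Poly_Mapping.keys c. eval p a = 0" by (simp add: in_keys_iff)
qed (simp add: act_trig_sum)

lemma supp_trig_sum:
  "Poly_Mapping.keys c \<subseteq> rational_points \<Longrightarrow> supp (trig_sum c) = Poly_Mapping.keys c"
  by (auto simp: supp_def fourier_coeffs_trig_sum in_keys_iff)

lemma PT_fin_supp_subset: "f \<in> PT_fin \<Longrightarrow> supp f \<subseteq> rational_points"
  by (auto simp: PT_fin_def supp_trig_sum)

lemma act_PT_fin_eq_0_iff:
  "f \<in> PT_fin \<Longrightarrow> act p f = (\<lambda>x. 0) \<longleftrightarrow> (\<forall>a\<in>supp f. eval p a = 0)"
  by (auto simp: PT_fin_def act_trig_sum_eq_0_iff supp_trig_sum)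

lemma exponential_in_PT_fin:
  assumes "a \<in> rational_points"
  shows "exponential a \<in> PT_fin" and "supp (exponential a) = {a}"
proof -
  have e: "exponential a = trig_sum (Poly_Mapping.single a 1)"
    by (simp add: trig_sum_def fun_eq_iff)
  show "exponential a \<in> PT_fin" unfolding PT_fin_def e using assms by fastforce
  show "supp (exponential a) = {a}" unfolding e using assms by (subst supp_trig_sum) auto
qed

section \<open>Behaviors\<close>

lemma orth_iff:
  assumes "f \<in> PT_fin"
  shows "f \<in> orth I \<longleftrightarrow> supp f \<subseteq> rational_variety I"
  using assms PT_fin_supp_subset[OF assms]
  by (auto simp: orth_def act_PT_fin_eq_0_iff rational_variety_def variety_def)

lemma orth_eq: "orth I = {f \<in> PT_fin. supp f \<subseteq> rational_variety I}"
  using orth_iff by (auto simp: orth_def)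

text \<open>Single exponentials with frequency in \<open>rational_variety I\<close> lie in
  \<open>orth I\<close> and test vanishing at each such point; conversely, elements of
  \<open>orth I\<close> involve only these frequencies.\<close>

lemma annihilator_orth: "annihilator (orth I) = vanishing_ideal (rational_variety I)"
proof
  show "annihilator (orth I) \<subseteq> vanishing_ideal (rational_variety I)"
  proof (clarsimp simp: vanishing_ideal_def)
    fix p a assume p: "p \<in> annihilator (orth I)" and a: "a \<in> rational_variety I"
    then have r: "a \<in> rational_points" by (simp add: rational_variety_def)
    have "exponential a \<in> orth I" using a by (simp add: orth_eq exponential_in_PT_fin[OF r])
    with p show "eval p a = 0"
      using act_PT_fin_eq_0_iff[of "exponential a" p]
      by (auto simp: annihilator_def exponential_in_PT_fin[OF r])
  qed
  show "vanishing_ideal (rational_variety I) \<subseteq> annihilator (orth I)"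
    by (auto simp: annihilator_def vanishing_ideal_def orth_eq act_PT_fin_eq_0_iff)
qed

lemma variety_annihilator_orth:
  "variety (annihilator (orth I)) = zariski_closure (rational_variety I)"
  by (simp add: annihilator_orth zariski_closure_eq)

text \<open>The inverse sends \<open>S = variety I\<close> to \<open>orth I\<close>. Density is
  stated as one inclusion; the other holds because \<open>S\<close> is closed.\<close>

lemma bij_betw_behaviors:
  "bij_betw (\<lambda>B. variety (annihilator B)) behaviors
    {S. zariski_closed S \<and> S \<subseteq> zariski_closure (S \<inter> rational_points)}" (is "bij_betw ?F _ ?C")
proof (rule bij_betw_imageI)
  show "inj_on ?F behaviors"
  proof (rule inj_onI)
    fix B B' :: "(real ^ 'a::{finite,linorder} \<Rightarrow> complex) set"
    assume "B \<in> behaviors" "B' \<in> behaviors" and eq: "?F B = ?F B'"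
    then obtain I I' where I: "is_ideal I" "B = orth I" and I': "is_ideal I'" "B' = orth I'"
      by (auto simp: behaviors_def)
    \<comment> \<open>The rational points of the image recover \<open>rational_variety I\<close>,
      which determines the behavior by \<open>orth_eq\<close>.\<close>
    have "rational_variety I = ?F B \<inter> rational_points" "rational_variety I' = ?F B' \<inter> rational_points"
      by (simp_all only: I I' variety_annihilator_orth zariski_closure_rational_points)
    then have "rational_variety I = rational_variety I'" by (simp only: eq)
    then show "B = B'" by (simp add: I(2) I'(2) orth_eq)
  qed
  show "?F ` behaviors = ?C"
  proof (intro equalityI subsetI)
    fix S assume "S \<in> ?F ` behaviors"
    then obtain I where I: "is_ideal I" and S: "S = zariski_closure (rational_variety I)"
      by (auto simp: behaviors_def variety_annihilator_orth)
    have "zariski_closed S"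
      unfolding S zariski_closure_eq by (intro zariski_closed_variety is_ideal_vanishing_ideal)
    then show "S \<in> ?C" by (simp add: S zariski_closure_rational_points[OF I])
  next
    fix S assume "S \<in> ?C"
    then obtain I where I: "is_ideal I" "S = variety I"
      and dense: "S \<subseteq> zariski_closure (S \<inter> rational_points)"
      by (auto simp: zariski_closed_def)
    \<comment> \<open>Density gives \<subseteq>; minimality of the closure inside the closed set
      \<open>variety I\<close> gives the converse.\<close>
    have "S = ?F (orth I)"
      using dense zariski_closure_rational_variety_subset[OF I(1)]
      by (auto simp: variety_annihilator_orth I rational_variety_def)
    then show "S \<in> ?F ` behaviors" using I(1) by (auto simp: behaviors_def)
  qed
qed

theorem mainTheorem8:
  assumes "CARD('n::{finite,linorder}) \<ge> 2"
  shows "(\<forall>I :: 'n diffop set. is_ideal I \<longrightarrow>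
      (\<forall>f\<in>PT_fin. f \<in> orth I \<longleftrightarrow> supp f \<subseteq> rational_variety I) \<and>
      annihilator (orth I) = {p. \<forall>a\<in>rational_variety I. eval p a = 0} \<and>
      annihilator (orth I) =
        (\<Inter>a\<in>rational_variety I. ideal_generated (range (\<lambda>j. var j - const (a $ j)))) \<and>
      annihilator (orth I) = vanishing_ideal (zariski_closure (rational_variety I)) \<and>
      variety (annihilator (orth I)) = zariski_closure (rational_variety I)) \<and>
    bij_betw (\<lambda>B. variety (annihilator B))
      (behaviors :: (real ^ 'n::{finite,linorder} \<Rightarrow> complex) set set)
      {S. zariski_closed S \<and> S \<subseteq> zariski_closure (S \<inter> rational_points)}"
proof -
  have points: "{p. \<forall>a\<in>S. eval p a = 0} = vanishing_ideal S" for S :: "(complex ^ 'n::{finite,linorder}) set"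
    by (simp add: vanishing_ideal_def)
  \<comment> \<open>With each point ideal equal to \<open>vanishing_ideal {a}\<close>, the
    intersection is the vanishing ideal of the union of the points; for empty \<open>S\<close> both
    sides are the whole ring.\<close>
  have ideals: "(\<Inter>a\<in>S. ideal_generated (range (\<lambda>j. var j - const (a $ j)))) = vanishing_ideal S"
    for S :: "(complex ^ 'n::{finite,linorder}) set"
    unfolding maximal_ideal_eq_vanishing_ideal by (auto simp: vanishing_ideal_def)
  show ?thesis
    unfolding points ideals annihilator_orth vanishing_ideal_zariski_closure
    using orth_iff bij_betw_behaviors zariski_closure_eq by blast
qed

end
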